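(* Let $X_1,X_2$ be real random variables, let $g(u)=F_{X_1}^{-1}(u)+F_{X_2}^{-1}(1-u)$ for $u\in(0,1)$, and let $x^{\min}=\inf_{u\in(0,1)} g(u)$, $x^{\max}=\sup_{u\in(0,1)} g(u)$. For any $x\in(x^{\min},x^{\max})$ and any element $u_{x,j}$ of the set $E_x$, there exists $\alpha_{x,j}\in[0,1]$ satisfying $$x=F_{X_1}^{-1(\alpha_{x,j})}(u_{x,j})+F_{X_2}^{-1(1-\alpha_{x,j})}(1-u_{x,j}).$$ Moreover, it is given by $$\alpha_{x,j}=\begin{cases}\dfrac{x-g(u_{x,j}-)}{g(u_{x,j}+)-g(u_{x,j}-)}, & \text{if } g(u_{x,j}+)\neq g(u_{x,j}-),\\[2mm] 0, & \text{if } g(u_{x,j}+)=g(u_{x,j}-),\end{cases}$$ where $g(u_{x,j}+)$ and $g(u_{x,j}-)$ denote the right and left limits of $g$ at $u_{x,j}$.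
   Context: Random variables may be discrete, continuous, or a combination of the two. For a real random variable $X$ with cdf $F_X$: $F_X^{-1}(p)=\inf\{y\in\mathbb{R}: F_X(y)\ge p\}$ (left inverse), $F_X^{-1+}(p)=\sup\{y\in\mathbb{R}: F_X(y)\le p\}$ (right inverse), with $\inf\emptyset=+\infty$, $\sup\emptyset=-\infty$, and for $\alpha\in[0,1]$ the generalized inverse is $F_X^{-1(\alpha)}(p)=(1-\alpha)F_X^{-1}(p)+\alpha F_X^{-1+}(p)$. Set $E_x$ (associated with $g$), for $x\in(x^{\min},x^{\max})$: a point $u^*\in(0,1)$ belongs to $E_x$ if and only if there exist $a,b,c\in[0,1]$ with $a<b\le u^*<c$ such that one of the following holds: (1) $g(u)<x$ for $u\in(a,b)$, $g(u)=x$ for $u\in(b,u^* )$, and $g(u)>x$ for $u\in(u^*,c)$; (2) $g(u)>x$ for $u\in(a,b)$, $g(u)=x$ for $u\in(b,u^* )$, and $g(u)<x$ for $u\in(u^*,c)$. (If $b=u^*$ the middle requirement is vacuous.) *)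

theory Defs
  imports "HOL-Probability.Probability"
begin

text \<open>
  Generalized inverses are extended-real valued, so that \<open>Inf {} = \<infinity>\<close> and
  \<open>Sup {} = -\<infinity>\<close> are the intended conventions (in type \<open>real\<close> both are junk values).
\<close>

definition left_inverse :: "(real \<Rightarrow> real) \<Rightarrow> real \<Rightarrow> ereal" where
  "left_inverse F p = Inf (ereal ` {y. F y \<ge> p})"

definition right_inverse :: "(real \<Rightarrow> real) \<Rightarrow> real \<Rightarrow> ereal" where
  "right_inverse F p = Sup (ereal ` {y. F y \<le> p})"

definition gen_inverse :: "(real \<Rightarrow> real) \<Rightarrow> real \<Rightarrow> real \<Rightarrow> ereal" where
  "gen_inverse F \<alpha> p = ereal (1 - \<alpha>) * left_inverse F p + ereal \<alpha> * right_inverse F p"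

definition E_set :: "(real \<Rightarrow> ereal) \<Rightarrow> real \<Rightarrow> real set" where
  "E_set g x = {u \<in> {0<..<1}. \<exists>a\<in>{0..1}. \<exists>b\<in>{0..1}. \<exists>c\<in>{0..1}. a < b \<and> b \<le> u \<and> u < c \<and>
     ((\<forall>v\<in>{a<..<b}. g v < ereal x) \<and> (\<forall>v\<in>{b<..<u}. g v = ereal x) \<and> (\<forall>v\<in>{u<..<c}. g v > ereal x) \<or>
      (\<forall>v\<in>{a<..<b}. g v > ereal x) \<and> (\<forall>v\<in>{b<..<u}. g v = ereal x) \<and> (\<forall>v\<in>{u<..<c}. g v < ereal x))}"

end

theory Submission
  imports Defs
begin

text \<open>
  For a nondecreasing \<open>F\<close> the left inverse has left limit \<open>left_inverse F p\<close> and right limit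
  \<open>right_inverse F p\<close> at every \<open>p\<close>.  Hence the one-sided limits of \<open>g\<close> at \<open>u\<close> are
  \<open>left_inverse F\<^sub>1 u + right_inverse F\<^sub>2 (1 - u)\<close> and \<open>right_inverse F\<^sub>1 u + left_inverse F\<^sub>2 (1 - u)\<close>,
  and the right-hand side of the claimed identity is their convex combination with weights
  \<open>1 - \<alpha>\<close> and \<open>\<alpha>\<close>.  Membership of \<open>u\<close> in \<open>E_set g x\<close> places \<open>x\<close> between the two limits.
\<close>

lemma left_inverse_le: "p \<le> F t \<Longrightarrow> left_inverse F p \<le> ereal t"
  unfolding left_inverse_def by (rule Inf_lower) simp

lemma right_inverse_ge: "F t \<le> p \<Longrightarrow> ereal t \<le> right_inverse F p"
  unfolding right_inverse_def by (rule Sup_upper) simp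

lemma le_left_inverse:
  assumes "mono F" "F t < p"
  shows "ereal t \<le> left_inverse F p"
  unfolding left_inverse_def
proof (rule Inf_greatest)
  fix z assume "z \<in> ereal ` {y. F y \<ge> p}"
  then obtain y where "z = ereal y" "p \<le> F y" by auto
  then show "ereal t \<le> z"
    using assms by (metis ereal_less_eq(3) linorder_linear monoD order.strict_trans1 order_less_irrefl order_le_less_trans)
qed

lemma right_inverse_le:
  assumes "mono F" "p < F t"
  shows "right_inverse F p \<le> ereal t"
  unfolding right_inverse_def
proof (rule Sup_least)
  fix z assume "z \<in> ereal ` {y. F y \<le> p}"
  then obtain y where "z = ereal y" "F y \<le> p" by auto
  then show "z \<le> ereal t"
    using assms by (metis ereal_less_eq(3) linorder_linear monoD order_less_irrefl order_le_less_trans order_less_le_trans)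
qed

lemma left_inverse_mono: "p \<le> q \<Longrightarrow> left_inverse F p \<le> left_inverse F q"
  unfolding left_inverse_def by (intro Inf_superset_mono image_mono) auto

text \<open>Every \<open>y\<close> with \<open>F y\<close> \<le> \<open>p\<close> satisfies
  \<open>F y < q\<close>, so by monotonicity it bounds the set defining
  \<open>left_inverse F q\<close> from below.\<close>

lemma right_inverse_le_left_inverse:
  assumes "mono F" "p < q"
  shows "right_inverse F p \<le> left_inverse F q"
  unfolding right_inverse_def
proof (rule Sup_least)
  fix z assume "z \<in> ereal ` {y. F y \<le> p}"
  then show "z \<le> left_inverse F q"
    using le_left_inverse[OF assms(1)] assms(2) by force
qed

text \<open>A real \<open>t\<close> with \<open>a < t < left_inverse F p\<close> has
  \<open>F t < p\<close>, and then \<open>t\<close> is a lower bound for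
  \<open>left_inverse F v\<close> for all \<open>v\<close> between \<open>F t\<close> and
  \<open>p\<close>. The upper estimate is monotonicity in \<open>p\<close>.\<close>

lemma left_inverse_at_left:
  assumes "mono F"
  shows "(left_inverse F \<longlongrightarrow> left_inverse F p) (at_left p)"
proof (rule order_tendstoI)
  fix a assume "a < left_inverse F p"
  then obtain t where t: "a < ereal t" "ereal t < left_inverse F p"
    using ereal_dense2 by blast
  then have "F t < p"
    using left_inverse_le[of p F t] by force
  then show "\<forall>\<^sub>F v in at_left p. a < left_inverse F v"
    using eventually_at_left_real[of "F t" p] le_left_inverse[OF assms] t(1)
    by (auto elim!: eventually_mono intro: order_less_le_trans)
next
  fix a assume "left_inverse F p < a"
  then show "\<forall>\<^sub>F v in at_left p. left_inverse F v < a"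
    by (auto simp: eventually_at_filter intro!: always_eventually
        intro: order_le_less_trans[OF left_inverse_mono[OF less_imp_le]])
qed

text \<open>A real \<open>t\<close> with \<open>right_inverse F p < t < a\<close> has
  \<open>p < F t\<close>, so \<open>left_inverse F v\<close> \<le> \<open>t\<close> for all
  \<open>v\<close> between \<open>p\<close> and \<open>F t\<close>. The lower estimate is
  \<open>right_inverse_le_left_inverse\<close>.\<close>

lemma left_inverse_at_right:
  assumes "mono F"
  shows "(left_inverse F \<longlongrightarrow> right_inverse F p) (at_right p)"
proof (rule order_tendstoI)
  fix a assume "right_inverse F p < a"
  then obtain t where t: "right_inverse F p < ereal t" "ereal t < a"
    using ereal_dense2 by blast
  then have "p < F t"
    using right_inverse_ge[of F t p] by force
  then show "\<forall>\<^sub>F v in at_right p. left_inverse F v < a"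
    using eventually_at_right_real[of p "F t"] t(2)
    by (auto elim!: eventually_mono intro: order_le_less_trans[OF left_inverse_le[of _ F t, OF less_imp_le]])
next
  fix a assume "a < right_inverse F p"
  then show "\<forall>\<^sub>F v in at_right p. a < left_inverse F v"
    by (auto simp: eventually_at_filter intro!: always_eventually
        intro: order_less_le_trans[OF _ right_inverse_le_left_inverse[OF assms]])
qed

text \<open>The limits of \<open>F\<close> at both ends supply \<open>s\<close> and \<open>t\<close>
  with \<open>F s < p < F t\<close>, which enclose both inverses. Finiteness makes addition in
  \<open>ereal\<close> continuous at these values.\<close>

lemma generalized_inverses_finite:
  assumes "mono F" and bot: "(F \<longlongrightarrow> 0) at_bot" and top: "(F \<longlongrightarrow> 1) at_top"
    and p: "0 < p" "p < 1"
  shows "\<exists>l r. left_inverse F p = ereal l \<and> right_inverse F p = ereal r"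
proof -
  obtain s where s: "F s < p"
    using eventually_happens[OF order_tendstoD(2)[OF bot p(1)]] by auto
  obtain t where t: "p < F t"
    using eventually_happens[OF order_tendstoD(1)[OF top p(2)]] by auto
  have "ereal s \<le> left_inverse F p" "left_inverse F p \<le> ereal t"
    using le_left_inverse[OF assms(1) s] left_inverse_le t by auto
  moreover have "ereal s \<le> right_inverse F p" "right_inverse F p \<le> ereal t"
    using right_inverse_le[OF assms(1) t] right_inverse_ge s by auto
  ultimately show ?thesis
    by (cases "left_inverse F p"; cases "right_inverse F p") auto
qed

text \<open>Reflection swaps the two sides, so the right inverse of the second cdf enters the left
  limit of \<open>g\<close>.\<close>

lemma filterlim_reflect_at_left: "filterlim (\<lambda>v. c - v) (at_right (c - u)) (at_left (u::real))"
  unfolding filterlim_at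
  by (auto simp: eventually_at_filter intro!: tendsto_intros always_eventually)

lemma filterlim_reflect_at_right: "filterlim (\<lambda>v. c - v) (at_left (c - u)) (at_right (u::real))"
  unfolding filterlim_at
  by (auto simp: eventually_at_filter intro!: tendsto_intros always_eventually)

text \<open>On each side of \<open>u\<close>, close to it, \<open>g\<close> stays weakly on one side
  of \<open>x\<close>; weak inequalities pass to the limits.\<close>

lemma E_set_between_limits:
  assumes u: "u \<in> E_set g x"
    and l: "(g \<longlongrightarrow> ereal gl) (at_left u)" and r: "(g \<longlongrightarrow> ereal gr) (at_right u)"
  shows "gl \<le> x \<and> x \<le> gr \<or> gr \<le> x \<and> x \<le> gl"
proof -
  obtain a b c where abc: "a < b" "b \<le> u" "u < c"
    and cases: "(\<forall>v\<in>{a<..<b}. g v < ereal x) \<and> (\<forall>v\<in>{b<..<u}. g v = ereal x) \<and> (\<forall>v\<in>{u<..<c}. g v > ereal x) \<or>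
      (\<forall>v\<in>{a<..<b}. g v > ereal x) \<and> (\<forall>v\<in>{b<..<u}. g v = ereal x) \<and> (\<forall>v\<in>{u<..<c}. g v < ereal x)"
    using u unfolding E_set_def by blast
  have ev_right: "\<forall>\<^sub>F v in at_right u. v \<in> {u<..<c}"
    using abc by (intro eventually_at_right_real)
  \<comment> \<open>If \<open>b = u\<close> the middle interval is empty and the strict inequality
    on the first interval reaches up to \<open>u\<close>; otherwise \<open>g\<close> equals
    \<open>x\<close> just left of \<open>u\<close>.\<close>
  have ev_left: "\<forall>\<^sub>F v in at_left u. v \<in> (if b = u then {a<..<b} else {b<..<u})"
    using abc eventually_at_left_real[of a u] eventually_at_left_real[of b u] by auto
  show ?thesis
    using cases
  proof (elim disjE conjE)
    assume h: "\<forall>v\<in>{a<..<b}. g v < ereal x" "\<forall>v\<in>{b<..<u}. g v = ereal x" "\<forall>v\<in>{u<..<c}. g v > ereal x"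
    have "\<forall>\<^sub>F v in at_left u. g v \<le> ereal x"
      using ev_left h by (auto elim!: eventually_mono split: if_splits intro: less_imp_le)
    then have "ereal gl \<le> ereal x"
      by (rule tendsto_upperbound[OF l]) simp
    moreover have "\<forall>\<^sub>F v in at_right u. ereal x \<le> g v"
      using ev_right h by (auto elim!: eventually_mono intro: less_imp_le)
    then have "ereal x \<le> ereal gr"
      by (rule tendsto_lowerbound[OF r]) simp
    ultimately show ?thesis by simp
  next
    assume h: "\<forall>v\<in>{a<..<b}. g v > ereal x" "\<forall>v\<in>{b<..<u}. g v = ereal x" "\<forall>v\<in>{u<..<c}. g v < ereal x"
    have "\<forall>\<^sub>F v in at_left u. ereal x \<le> g v"
      using ev_left h by (auto elim!: eventually_mono split: if_splits intro: less_imp_le)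
    then have "ereal x \<le> ereal gl"
      by (rule tendsto_lowerbound[OF l]) simp
    moreover have "\<forall>\<^sub>F v in at_right u. g v \<le> ereal x"
      using ev_right h by (auto elim!: eventually_mono intro: less_imp_le)
    then have "ereal gr \<le> ereal x"
      by (rule tendsto_upperbound[OF r]) simp
    ultimately show ?thesis by simp
  qed
qed

text \<open>For \<open>gl\<close> \<noteq> \<open>gr\<close> the weight is the unique solution of a
  linear equation. For \<open>gl = gr\<close> both equal \<open>x\<close>, so every weight works and
  0 is the value chosen.\<close>

lemma convex_weight_between:
  fixes gl gr x :: real
  assumes "gl \<le> x \<and> x \<le> gr \<or> gr \<le> x \<and> x \<le> gl"
  defines "\<alpha> \<equiv> if gr \<noteq> gl then (x - gl) / (gr - gl) else 0"
  shows "\<alpha> \<in> {0..1}" and "x = (1 - \<alpha>) * gl + \<alpha> * gr"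
proof -
  show "\<alpha> \<in> {0..1}"
    using assms(1) unfolding \<alpha>_def by (auto simp: divide_simps)
  have "\<alpha> * (gr - gl) = x - gl"
    using assms(1) unfolding \<alpha>_def by auto
  then show "x = (1 - \<alpha>) * gl + \<alpha> * gr"
    by (simp add: algebra_simps)
qed

theorem lemma4p1:
  fixes M :: "'a measure" and X\<^sub>1 X\<^sub>2 :: "'a \<Rightarrow> real" and x u :: real
  defines "F\<^sub>1 \<equiv> cdf (distr M borel X\<^sub>1)"
    and "F\<^sub>2 \<equiv> cdf (distr M borel X\<^sub>2)"
  defines "g \<equiv> \<lambda>v. left_inverse F\<^sub>1 v + left_inverse F\<^sub>2 (1 - v)"
  assumes "prob_space M"
    and "X\<^sub>1 \<in> borel_measurable M" and "X\<^sub>2 \<in> borel_measurable M"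
    and "(INF v\<in>{0<..<1}. g v) < ereal x" and "ereal x < (SUP v\<in>{0<..<1}. g v)"
    and "u \<in> E_set g x"
  shows "\<exists>g_left g_right \<alpha> :: real.
      (g \<longlongrightarrow> ereal g_left) (at_left u) \<and> (g \<longlongrightarrow> ereal g_right) (at_right u) \<and>
      \<alpha> \<in> {0..1} \<and>
      ereal x = gen_inverse F\<^sub>1 \<alpha> u + gen_inverse F\<^sub>2 (1 - \<alpha>) (1 - u) \<and>
      \<alpha> = (if g_right \<noteq> g_left then (x - g_left) / (g_right - g_left) else 0)"
proof -
  have u: "0 < u" "u < 1"
    using \<open>u \<in> E_set g x\<close> by (auto simp: E_set_def)
  interpret D\<^sub>1: real_distribution "distr M borel X\<^sub>1"
    by (rule prob_space.real_distribution_distr) fact+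
  interpret D\<^sub>2: real_distribution "distr M borel X\<^sub>2"
    by (rule prob_space.real_distribution_distr) fact+
  have mono: "mono F\<^sub>1" "mono F\<^sub>2"
    unfolding F\<^sub>1_def F\<^sub>2_def by (auto intro!: monoI D\<^sub>1.cdf_nondecreasing D\<^sub>2.cdf_nondecreasing)
  obtain l\<^sub>1 r\<^sub>1 where 1: "left_inverse F\<^sub>1 u = ereal l\<^sub>1" "right_inverse F\<^sub>1 u = ereal r\<^sub>1"
    using generalized_inverses_finite[OF mono(1) _ _ u] D\<^sub>1.cdf_lim_at_bot D\<^sub>1.cdf_lim_at_top_prob
    unfolding F\<^sub>1_def by auto
  obtain l\<^sub>2 r\<^sub>2 where 2: "left_inverse F\<^sub>2 (1 - u) = ereal l\<^sub>2" "right_inverse F\<^sub>2 (1 - u) = ereal r\<^sub>2"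
    using generalized_inverses_finite[OF mono(2), of "1 - u"] u D\<^sub>2.cdf_lim_at_bot D\<^sub>2.cdf_lim_at_top_prob
    unfolding F\<^sub>2_def by auto
  define gl gr where "gl = l\<^sub>1 + r\<^sub>2" and "gr = r\<^sub>1 + l\<^sub>2"
  have l: "(g \<longlongrightarrow> ereal gl) (at_left u)"
    using tendsto_add_ereal[OF _ _ left_inverse_at_left[OF mono(1)]
        filterlim_compose[OF left_inverse_at_right[OF mono(2)] filterlim_reflect_at_left], of u 1]
    by (simp add: 1 2 gl_def g_def)
  have r: "(g \<longlongrightarrow> ereal gr) (at_right u)"
    using tendsto_add_ereal[OF _ _ left_inverse_at_right[OF mono(1)]
        filterlim_compose[OF left_inverse_at_left[OF mono(2)] filterlim_reflect_at_right], of u 1]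
    by (simp add: 1 2 gr_def g_def)
  define \<alpha> where "\<alpha> = (if gr \<noteq> gl then (x - gl) / (gr - gl) else 0)"
  note \<alpha> = convex_weight_between[OF E_set_between_limits[OF \<open>u \<in> E_set g x\<close> l r], folded \<alpha>_def]
  \<comment> \<open>The parameter \<open>1 - \<alpha>\<close> for the second cdf gives
    \<open>l\<^sub>2\<close> the weight \<alpha> and \<open>r\<^sub>2\<close> the weight
    \<open>1 - \<alpha>\<close>, so the terms regroup into \<open>gr\<close> and
    \<open>gl\<close>.\<close>
  have "ereal x = gen_inverse F\<^sub>1 \<alpha> u + gen_inverse F\<^sub>2 (1 - \<alpha>) (1 - u)"
    unfolding gen_inverse_def 1 2 using \<alpha>(2) by (simp add: gl_def gr_def algebra_simps)
  then show ?thesis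
    using l r \<alpha>(1) \<alpha>_def by blast
qed

end
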